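(* Let $\alpha$ be a countable ordinal. Let $(Y,d)$ be a metric space and let $(X,\mathcal{T}(X))$, $(Z,\mathcal{T}(Z))$ be two perfectly normal topological spaces. Let $\mathcal{T}(Y)$ be a topology on $Y$ which is finer than the topology induced by $d$ and such that $(Y,\mathcal{T}(Y))$ is separable. Let $S$ be a countable $\mathcal{T}(Y)$-dense subset of $Y$. Suppose that to every point $v\in Y$ there corresponds a subset $U(v)\in\mathcal{T}(Y)$ such that (i) for every $y\in S$, the set $B(y)=\{v\in Y: y\in U(v)\}$ belongs to $\Sigma_\alpha(Y,d)$; and (ii) for every $v\in Y$, the family $\mathcal{N}(v)=\{U(v)\cap B(v,2^{-n}): n=1,2,\ldots\}$, where $B(v,2^{-n})$ denotes the open $d$-ball centered at $v$ with radius $2^{-n}$, forms a filterbase of $\mathcal{T}(Y)$-neighbourhoods of the point $v$. Let $F:X\times Y\to Z$ be a compact-valued multivalued function such that every $y$-section $F^{y}$ ($y\in Y$) is of $\mathcal{T}(X)$-lower Borel class $\alpha$ and every $x$-section $F_x$ ($x\in X$) is $\mathcal{T}(Y)$-continuous. Then $F$ is of upper Borel class $\alpha+1$ on the product of the topological spaces $(X,\mathcal{T}(X))$ and $(Y,d)$.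
   Context: A multivalued function $\Phi:T\to Z$ assigns to each $t\in T$ a nonempty subset $\Phi(t)\subset Z$; it is compact-valued if each $\Phi(t)$ is a compact subset of $Z$. For $G\subset Z$ put $\Phi^+(G)=\{t\in T:\Phi(t)\subset G\}$ and $\Phi^-(G)=\{t\in T:\Phi(t)\cap G\neq\emptyset\}$. Let $(T,\mathcal{T}(T))$ and $(Z,\mathcal{T}(Z))$ be topological spaces. $\Phi$ is $\mathcal{T}(T)$-upper (resp. $\mathcal{T}(T)$-lower) semicontinuous if $\Phi^+(G)\in\mathcal{T}(T)$ (resp. $\Phi^-(G)\in\mathcal{T}(T)$) for every $G\in\mathcal{T}(Z)$; it is $\mathcal{T}(T)$-continuous if it is both $\mathcal{T}(T)$-upper and $\mathcal{T}(T)$-lower semicontinuous. For a countable ordinal $\alpha$, $\Sigma_\alpha(T)$ and $\Pi_\alpha(T)$ denote the additive and multiplicative class $\alpha$ in the Borel hierarchy of $(T,\mathcal{T}(T))$, indexed from $0$: $\Sigma_0(T)$ is the family of open sets, $\Pi_\alpha(T)$ consists of the complements of members of $\Sigma_\alpha(T)$, and for $\alpha>0$, $\Sigma_\alpha(T)$ consists of countable unions of members of $\bigcup_{\beta<\alpha}\Pi_\beta(T)$. $\Sigma_\alpha(Y,d)$ refers to the metric topology of $(Y,d)$. $\Phi$ is of $\mathcal{T}(T)$-lower (resp. $\mathcal{T}(T)$-upper) Borel class $\alpha$ if $\Phi^-(G)\in\Sigma_\alpha(T)$ (resp. $\Phi^+(G)\in\Sigma_\alpha(T)$) for every $G\in\mathcal{T}(Z)$.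 For a multivalued function $F:X\times Y\to Z$, the $x$-section is $F_x:Y\to Z$, $F_x(y)=F(x,y)$, and the $y$-section is $F^y:X\to Z$, $F^y(x)=F(x,y)$. "Filterbase of $\mathcal{T}(Y)$-neighbourhoods of $v$" means a local base at $v$: its members are $\mathcal{T}(Y)$-neighbourhoods of $v$, and every $\mathcal{T}(Y)$-neighbourhood of $v$ contains one of them. *)

theory Defs
  imports "HOL-Analysis.Analysis"
begin

section \<open>Countable ordinals\<close>

text \<open>
  The countable ordinals are the elements of the first uncountable ordinal, which is the
  cardinal successor of \<open>natLeq\<close>. The lemmas \<open>countable_lessThan_omega1\<close>,
  \<open>uncountable_UNIV_omega1\<close> and the wellorder instance below characterise this
  order type up to isomorphism.
\<close>

typedef omega1 = "Field (cardSuc natLeq)"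
  using Field_cardSuc_not_empty[OF natLeq_Card_order] by blast

instantiation omega1 :: linorder
begin

definition less_eq_omega1 :: "omega1 \<Rightarrow> omega1 \<Rightarrow> bool" where
  "a \<le> b \<longleftrightarrow> (Rep_omega1 a, Rep_omega1 b) \<in> cardSuc natLeq"

definition less_omega1 :: "omega1 \<Rightarrow> omega1 \<Rightarrow> bool" where
  "a < b \<longleftrightarrow> a \<le> b \<and> \<not> b \<le> (a :: omega1)"

instance
proof -
  have "Well_order (cardSuc natLeq)"
    by (rule cardSuc_Well_order[OF natLeq_Card_order])
  then have lin: "refl_on (Field (cardSuc natLeq)) (cardSuc natLeq)" "trans (cardSuc natLeq)"
      "antisym (cardSuc natLeq)" "total_on (Field (cardSuc natLeq)) (cardSuc natLeq)"
    by (auto simp: well_order_on_def linear_order_on_def partial_order_on_def preorder_on_def)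
  show "OFCLASS(omega1, linorder_class)"
  proof
    fix a b c :: omega1
    show "(a < b) = (a \<le> b \<and> \<not> b \<le> a)"
      by (rule less_omega1_def)
    show "a \<le> a"
      using lin(1) Rep_omega1 by (auto simp: less_eq_omega1_def refl_on_def)
    show "a \<le> b \<Longrightarrow> b \<le> c \<Longrightarrow> a \<le> c"
      using lin(2) by (auto simp: less_eq_omega1_def trans_def)
    show "a \<le> b \<Longrightarrow> b \<le> a \<Longrightarrow> a = b"
      unfolding less_eq_omega1_def by (drule (1) antisymD[OF lin(3)]) (simp add: Rep_omega1_inject)
    show "a \<le> b \<or> b \<le> a"
    proof (cases "a = b")
      case True
      with \<open>a \<le> a\<close> show ?thesis by simp
    next
      case False
      with lin(4) show ?thesis
        using Rep_omega1[of a] Rep_omega1[of b]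
        by (auto simp: less_eq_omega1_def total_on_def Rep_omega1_inject)
    qed
  qed
qed

end

instance omega1 :: wellorder
proof
  fix P :: "omega1 \<Rightarrow> bool" and a
  assume step: "\<And>x. (\<And>y. y < x \<Longrightarrow> P y) \<Longrightarrow> P x"
  have "wf (cardSuc natLeq - Id)"
    using cardSuc_Well_order[OF natLeq_Card_order] by (simp add: well_order_on_def)
  then have "wf (inv_image (cardSuc natLeq - Id) Rep_omega1)"
    by (rule wf_inv_image)
  then show "P a"
  proof (induction a rule: wf_induct_rule)
    case (less x)
    show ?case
    proof (rule step)
      fix y assume "y < x"
      then have "(y, x) \<in> inv_image (cardSuc natLeq - Id) Rep_omega1"
        by (auto simp: less_eq_omega1_def less_omega1_def Rep_omega1_inject)
      then show "P y" by (rule less)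
    qed
  qed
qed

lemma countable_lessThan_omega1:
  includes cardinal_syntax
  shows "countable {..< \<alpha> :: omega1}"
proof -
  let ?r = "cardSuc natLeq" and ?a = "Rep_omega1 \<alpha>"
  have "|underS ?r ?a| <o ?r"
    by (rule card_of_underS[OF cardSuc_Card_order[OF natLeq_Card_order] Rep_omega1])
  then have "|underS ?r ?a| \<le>o natLeq"
    using cardSuc_ordLeq_ordLess[OF natLeq_Card_order card_of_Card_order] by blast
  then have "|underS ?r ?a| \<le>o |UNIV :: nat set|"
    by (rule ordLeq_ordIso_trans[OF _ ordIso_symmetric[OF card_of_nat]])
  then have "countable (underS ?r ?a)"
    using card_of_ordLeq[of "underS ?r ?a" "UNIV :: nat set"] by (auto simp: countable_def)
  moreover have "Rep_omega1 ` {..<\<alpha>} \<subseteq> underS ?r ?a"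
    by (auto simp: underS_def less_eq_omega1_def less_omega1_def Rep_omega1_inject)
  ultimately have "countable (Rep_omega1 ` {..<\<alpha>})"
    by (rule countable_subset[rotated])
  then show ?thesis
    by (rule countable_image_inj_on) (simp add: inj_on_def Rep_omega1_inject)
qed

lemma uncountable_UNIV_omega1:
  includes cardinal_syntax
  shows "uncountable (UNIV :: omega1 set)"
proof
  let ?r = "cardSuc natLeq"
  assume "countable (UNIV :: omega1 set)"
  then have "countable (Rep_omega1 ` UNIV)" by (rule countable_image)
  moreover have "Rep_omega1 ` UNIV = Field ?r"
    using type_definition.Rep_range[OF type_definition_omega1] .
  ultimately have "countable (Field ?r)" by simp
  then have "|Field ?r| \<le>o |UNIV :: nat set|"
    using card_of_ordLeq[of "Field ?r" "UNIV :: nat set"] by (auto simp: countable_def)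
  then have "|Field ?r| \<le>o natLeq"
    by (rule ordLeq_ordIso_trans[OF _ card_of_nat])
  then have "?r \<le>o natLeq"
    by (rule ordIso_ordLeq_trans[OF ordIso_symmetric
          [OF card_of_Field_ordIso[OF cardSuc_Card_order[OF natLeq_Card_order]]]])
  then show False
    using cardSuc_greater[OF natLeq_Card_order] not_ordLess_ordLeq by blast
qed

instantiation omega1 :: zero
begin

definition zero_omega1 where
  "(0 :: omega1) = (LEAST \<alpha>. True)"

instance ..

end

definition ord_succ :: "omega1 \<Rightarrow> omega1" where
  "ord_succ \<alpha> = (LEAST \<beta>. \<alpha> < \<beta>)"

lemma zero_le_omega1: "0 \<le> (\<alpha> :: omega1)"
  unfolding zero_omega1_def by (rule Least_le) simp

lemma less_ord_succ: "\<alpha> < ord_succ \<alpha>"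
proof -
  have "\<exists>\<beta>. \<alpha> < \<beta>"
  proof (rule ccontr)
    assume "\<nexists>\<beta>. \<alpha> < \<beta>"
    then have "UNIV \<subseteq> insert \<alpha> {..<\<alpha>}"
      using linorder_less_linear by blast
    moreover have "countable (insert \<alpha> {..<\<alpha>})"
      by (intro countable_insert countable_lessThan_omega1)
    ultimately show False
      using uncountable_UNIV_omega1 countable_subset by blast
  qed
  then show ?thesis
    unfolding ord_succ_def by (rule LeastI_ex)
qed

lemma less_ord_succ_iff: "\<beta> < ord_succ \<alpha> \<longleftrightarrow> \<beta> \<le> \<alpha>"
proof
  assume "\<beta> < ord_succ \<alpha>"
  then show "\<beta> \<le> \<alpha>"
    unfolding ord_succ_def by (auto dest: not_less_Least)
next
  assume "\<beta> \<le> \<alpha>"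
  then show "\<beta> < ord_succ \<alpha>"
    using less_ord_succ by (rule le_less_trans)
qed


section \<open>The Borel hierarchy of a topological space\<close>

function Sigma_class :: "omega1 \<Rightarrow> 'a topology \<Rightarrow> 'a set set" where
  "Sigma_class \<alpha> T =
     (if \<alpha> = 0 then {A. openin T A}
      else {A. (countable union_of
                 (\<lambda>B. B \<in> (\<Union>\<beta>\<in>{..<\<alpha>}. (\<lambda>C. topspace T - C) ` Sigma_class \<beta> T))) A})"
  by pat_completeness auto
termination
  by (relation "inv_image {(\<beta>, \<alpha>). \<beta> < \<alpha>} fst") (auto simp: wf)

declare Sigma_class.simps [simp del]

definition Pi_class :: "omega1 \<Rightarrow> 'a topology \<Rightarrow> 'a set set" where
  "Pi_class \<alpha> T = (\<lambda>C. topspace T - C) ` Sigma_class \<alpha> T"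

lemma Sigma_class_zero: "Sigma_class 0 T = {A. openin T A}"
  by (simp add: Sigma_class.simps)

lemma Sigma_class_pos:
  assumes "0 < \<alpha>"
  shows "Sigma_class \<alpha> T = {A. (countable union_of (\<lambda>B. B \<in> (\<Union>\<beta>\<in>{..<\<alpha>}. Pi_class \<beta> T))) A}"
  using assms by (subst Sigma_class.simps) (auto simp: Pi_class_def)


section \<open>Perfect normality and local bases\<close>

text \<open>As for \<^const>\<open>normal_space\<close>, no separation axiom T1 is included.\<close>

definition perfectly_normal_space :: "'a topology \<Rightarrow> bool" where
  "perfectly_normal_space T \<longleftrightarrow> normal_space T \<and> (\<forall>C. closedin T C \<longrightarrow> gdelta_in T C)"

definition nhd_in :: "'a topology \<Rightarrow> 'a \<Rightarrow> 'a set \<Rightarrow> bool" where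
  "nhd_in T v N \<longleftrightarrow> N \<subseteq> topspace T \<and> (\<exists>W. openin T W \<and> v \<in> W \<and> W \<subseteq> N)"

definition nhd_filterbase :: "'a topology \<Rightarrow> 'a \<Rightarrow> 'a set set \<Rightarrow> bool" where
  "nhd_filterbase T v \<N> \<longleftrightarrow>
     (\<forall>N\<in>\<N>. nhd_in T v N) \<and> (\<forall>M. nhd_in T v M \<longrightarrow> (\<exists>N\<in>\<N>. N \<subseteq> M))"


section \<open>Multivalued functions\<close>

text \<open>
  A multivalued function from \<open>A\<close> to \<open>B\<close> is a total set-valued function of which
  only the values on \<open>A\<close> matter; all inverse images are therefore taken within \<open>A\<close>.
\<close>

definition multifunction :: "'a set \<Rightarrow> 'b set \<Rightarrow> ('a \<Rightarrow> 'b set) \<Rightarrow> bool" where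
  "multifunction A B \<Phi> \<longleftrightarrow> (\<forall>t\<in>A. \<Phi> t \<noteq> {} \<and> \<Phi> t \<subseteq> B)"

definition compact_valued :: "'a set \<Rightarrow> 'b topology \<Rightarrow> ('a \<Rightarrow> 'b set) \<Rightarrow> bool" where
  "compact_valued A Z \<Phi> \<longleftrightarrow> (\<forall>t\<in>A. compactin Z (\<Phi> t))"

definition upper_inverse :: "'a set \<Rightarrow> ('a \<Rightarrow> 'b set) \<Rightarrow> 'b set \<Rightarrow> 'a set" where
  "upper_inverse A \<Phi> G = {t \<in> A. \<Phi> t \<subseteq> G}"

definition lower_inverse :: "'a set \<Rightarrow> ('a \<Rightarrow> 'b set) \<Rightarrow> 'b set \<Rightarrow> 'a set" where
  "lower_inverse A \<Phi> G = {t \<in> A. \<Phi> t \<inter> G \<noteq> {}}"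

definition upper_semicontinuous :: "'a topology \<Rightarrow> 'b topology \<Rightarrow> ('a \<Rightarrow> 'b set) \<Rightarrow> bool" where
  "upper_semicontinuous T Z \<Phi> \<longleftrightarrow>
     (\<forall>G. openin Z G \<longrightarrow> openin T (upper_inverse (topspace T) \<Phi> G))"

definition lower_semicontinuous :: "'a topology \<Rightarrow> 'b topology \<Rightarrow> ('a \<Rightarrow> 'b set) \<Rightarrow> bool" where
  "lower_semicontinuous T Z \<Phi> \<longleftrightarrow>
     (\<forall>G. openin Z G \<longrightarrow> openin T (lower_inverse (topspace T) \<Phi> G))"

definition continuous_multifunction :: "'a topology \<Rightarrow> 'b topology \<Rightarrow> ('a \<Rightarrow> 'b set) \<Rightarrow> bool" where
  "continuous_multifunction T Z \<Phi> \<longleftrightarrow> upper_semicontinuous T Z \<Phi> \<and> lower_semicontinuous T Z \<Phi>"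

definition lower_Borel_class ::
    "omega1 \<Rightarrow> 'a topology \<Rightarrow> 'b topology \<Rightarrow> ('a \<Rightarrow> 'b set) \<Rightarrow> bool" where
  "lower_Borel_class \<alpha> T Z \<Phi> \<longleftrightarrow>
     (\<forall>G. openin Z G \<longrightarrow> lower_inverse (topspace T) \<Phi> G \<in> Sigma_class \<alpha> T)"

definition upper_Borel_class ::
    "omega1 \<Rightarrow> 'a topology \<Rightarrow> 'b topology \<Rightarrow> ('a \<Rightarrow> 'b set) \<Rightarrow> bool" where
  "upper_Borel_class \<alpha> T Z \<Phi> \<longleftrightarrow>
     (\<forall>G. openin Z G \<longrightarrow> upper_inverse (topspace T) \<Phi> G \<in> Sigma_class \<alpha> T)"

end

theory Submission
  imports Defs
begin

text \<open>
  Write \<open>G\<close> as the union of an increasing sequence of open sets \<open>G\<^sub>n\<close> with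
  \<open>cl G\<^sub>n \<subseteq> G\<close>. By compactness of the values and semicontinuity of the
  \<open>x\<close>-sections, \<open>F (x, v) \<subseteq> G\<close> holds iff for some \<open>n\<close> and \<open>k\<close> every
  \<open>y \<in> S \<inter> U v \<inter> B(v, 2\<^sup>-\<^sup>k)\<close> satisfies \<open>F (x, y) \<subseteq> cl G\<^sub>n\<close>.
  For fixed \<open>n\<close> and \<open>k\<close> the complement of this set is the countable union over
  \<open>y \<in> S\<close> of the rectangles
  \<open>{x. F (x, y) meets Z - cl G\<^sub>n} \<times> ({v. y \<in> U v} \<inter> B(y, 2\<^sup>-\<^sup>k))\<close>, whose sides
  have additive class \<open>\<alpha>\<close>.
\<close>

section \<open>Closure properties of the Borel classes, including products\<close>

lemma Sigma_class_subset_topspace: "A \<in> Sigma_class \<alpha> T \<Longrightarrow> A \<subseteq> topspace T"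
proof (cases "\<alpha> = 0")
  case True
  then show "A \<in> Sigma_class \<alpha> T \<Longrightarrow> A \<subseteq> topspace T"
    by (simp add: Sigma_class_zero openin_subset)
next
  case False
  then have "0 < \<alpha>"
    using zero_le_omega1[of \<alpha>] by simp
  then show "A \<in> Sigma_class \<alpha> T \<Longrightarrow> A \<subseteq> topspace T"
    by (auto simp: Sigma_class_pos union_of_def Pi_class_def)
qed

lemma Pi_class_iff:
  "A \<in> Pi_class \<alpha> T \<longleftrightarrow> A \<subseteq> topspace T \<and> topspace T - A \<in> Sigma_class \<alpha> T"
proof
  assume "A \<in> Pi_class \<alpha> T"
  then obtain C where C: "C \<in> Sigma_class \<alpha> T" "A = topspace T - C"
    by (auto simp: Pi_class_def)
  moreover have "topspace T - (topspace T - C) = C"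
    using Sigma_class_subset_topspace[OF C(1)] by blast
  ultimately show "A \<subseteq> topspace T \<and> topspace T - A \<in> Sigma_class \<alpha> T"
    by auto
next
  assume A: "A \<subseteq> topspace T \<and> topspace T - A \<in> Sigma_class \<alpha> T"
  then have "A = topspace T - (topspace T - A)" by blast
  with A show "A \<in> Pi_class \<alpha> T"
    unfolding Pi_class_def by blast
qed

lemma Sigma_class_UN:
  assumes "countable I" and "\<And>i. i \<in> I \<Longrightarrow> A i \<in> Sigma_class \<alpha> T"
  shows "(\<Union>i\<in>I. A i) \<in> Sigma_class \<alpha> T"
proof (cases "\<alpha> = 0")
  case True
  with assms show ?thesis by (auto simp: Sigma_class_zero)
next
  case False
  then have "0 < \<alpha>"
    using zero_le_omega1[of \<alpha>] by simp
  then show ?thesis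
    using assms by (simp add: Sigma_class_pos countable_union_of_UN)
qed

lemma Sigma_class_Un:
  assumes "A \<in> Sigma_class \<alpha> T" and "B \<in> Sigma_class \<alpha> T"
  shows "A \<union> B \<in> Sigma_class \<alpha> T"
  using Sigma_class_UN[of "{A, B}" "\<lambda>C. C" \<alpha> T] assms by auto

lemma Sigma_classE:
  assumes "A \<in> Sigma_class \<alpha> T" and "0 < \<alpha>"
  obtains \<U> where "countable \<U>" "\<And>B. B \<in> \<U> \<Longrightarrow> \<exists>\<beta><\<alpha>. B \<in> Pi_class \<beta> T" "A = \<Union>\<U>"
  using assms by (fastforce simp: Sigma_class_pos union_of_def)

text \<open>A union of one set suffices. Since \<open>\<beta> < \<alpha>\<close> is strict, this
  holds in every topological space and so can be applied in the product.\<close>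

lemma Pi_class_imp_Sigma_class:
  assumes "A \<in> Pi_class \<beta> T" and "\<beta> < \<alpha>"
  shows "A \<in> Sigma_class \<alpha> T"
proof -
  have "0 < \<alpha>"
    using zero_le_omega1[of \<beta>] assms(2) by (rule le_less_trans)
  then show ?thesis
    using assms by (auto simp: Sigma_class_pos intro: countable_union_of_inc)
qed

text \<open>For \<open>0 < \<beta>\<close> the unions that build class \<open>\<beta>\<close> are
  also admissible for \<open>\<alpha>\<close>. The start \<open>\<beta> = 0\<close> rests on
  \<open>gdelta\<close>: it makes every open set a countable union of closed sets, that is, of
  members of \<open>Pi_class 0 T\<close>.\<close>

lemma Sigma_class_mono:
  assumes gdelta: "\<And>C. closedin T C \<Longrightarrow> gdelta_in T C" and "\<beta> \<le> \<alpha>"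
  shows "Sigma_class \<beta> T \<subseteq> Sigma_class \<alpha> T"
proof
  fix A assume A: "A \<in> Sigma_class \<beta> T"
  consider "\<beta> = \<alpha>" | "\<beta> = 0" "0 < \<alpha>" | "0 < \<beta>" "\<beta> < \<alpha>"
    using \<open>\<beta> \<le> \<alpha>\<close> zero_le_omega1[of \<beta>] by (auto simp: le_less)
  then show "A \<in> Sigma_class \<alpha> T"
  proof cases
    case 1
    with A show ?thesis by simp
  next
    case 2
    then have "openin T A"
      using A by (simp add: Sigma_class_zero)
    then have "fsigma_in T A"
      using gdelta by (simp add: fsigma_in_gdelta_in openin_subset closedin_diff)
    then obtain C where C: "\<And>n::nat. closedin T (C n)" "A = (\<Union>n. C n)"
      by (auto simp: fsigma_in_ascending)
    have "C n \<in> Sigma_class \<alpha> T" for n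
      using C(1)[of n] 2
      by (intro Pi_class_imp_Sigma_class[where \<beta> = 0])
        (auto simp: Pi_class_iff Sigma_class_zero closedin_def)
    then show ?thesis
      unfolding C(2) by (intro Sigma_class_UN) auto
  next
    case 3
    obtain \<U> where \<U>: "countable \<U>" "\<And>B. B \<in> \<U> \<Longrightarrow> \<exists>\<gamma><\<beta>. B \<in> Pi_class \<gamma> T" "A = \<Union>\<U>"
      using Sigma_classE[OF A \<open>0 < \<beta>\<close>] by blast
    have "(\<Union>B\<in>\<U>. B) \<in> Sigma_class \<alpha> T"
    proof (rule Sigma_class_UN[OF \<U>(1)])
      fix B assume "B \<in> \<U>"
      then obtain \<gamma> where "\<gamma> < \<beta>" "B \<in> Pi_class \<gamma> T"
        using \<U>(2) by blast
      with 3 show "B \<in> Sigma_class \<alpha> T"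
        by (intro Pi_class_imp_Sigma_class[where \<beta> = \<gamma>]) auto
    qed
    then show ?thesis using \<U>(3) by simp
  qed
qed

lemma Pi_class_mono:
  assumes "\<And>C. closedin T C \<Longrightarrow> gdelta_in T C" and "\<beta> \<le> \<alpha>"
  shows "Pi_class \<beta> T \<subseteq> Pi_class \<alpha> T"
  unfolding Pi_class_def by (intro image_mono Sigma_class_mono assms)

text \<open>Induction on the class works because preimages commute with unions and
  complements.\<close>

lemma Sigma_class_continuous_preimage:
  assumes f: "continuous_map T T' f" and "A \<in> Sigma_class \<alpha> T'"
  shows "{x \<in> topspace T. f x \<in> A} \<in> Sigma_class \<alpha> T"
  using assms(2)
proof (induction \<alpha> arbitrary: A rule: less_induct)
  case (less \<alpha>)
  show ?case
  proof (cases "\<alpha> = 0")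
    case True
    with less.prems show ?thesis
      by (auto simp: Sigma_class_zero openin_continuous_map_preimage[OF f])
  next
    case False
    then have "0 < \<alpha>"
      using zero_le_omega1[of \<alpha>] by simp
    obtain \<U> where \<U>: "countable \<U>" "\<And>B. B \<in> \<U> \<Longrightarrow> \<exists>\<beta><\<alpha>. B \<in> Pi_class \<beta> T'" "A = \<Union>\<U>"
      using Sigma_classE[OF less.prems \<open>0 < \<alpha>\<close>] by blast
    have "(\<Union>B\<in>\<U>. {x \<in> topspace T. f x \<in> B}) \<in> Sigma_class \<alpha> T"
    proof (rule Sigma_class_UN[OF \<U>(1)])
      fix B assume "B \<in> \<U>"
      then obtain \<beta> where \<beta>: "\<beta> < \<alpha>" "B \<in> Pi_class \<beta> T'"
        using \<U>(2) by blast
      then have "{x \<in> topspace T. f x \<in> topspace T' - B} \<in> Sigma_class \<beta> T"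
        by (intro less.IH) (auto simp: Pi_class_iff)
      \<comment> \<open>Complements are relative to the carriers, so this relies on \<open>f\<close>
        mapping \<open>topspace T\<close> into \<open>topspace T'\<close>.\<close>
      moreover have "{x \<in> topspace T. f x \<in> topspace T' - B}
          = topspace T - {x \<in> topspace T. f x \<in> B}"
        using continuous_map_image_subset_topspace[OF f] by auto
      ultimately have "{x \<in> topspace T. f x \<in> B} \<in> Pi_class \<beta> T"
        by (auto simp: Pi_class_iff)
      then show "{x \<in> topspace T. f x \<in> B} \<in> Sigma_class \<alpha> T"
        using \<beta>(1) by (rule Pi_class_imp_Sigma_class)
    qed
    moreover have "{x \<in> topspace T. f x \<in> A} = (\<Union>B\<in>\<U>. {x \<in> topspace T. f x \<in> B})"
      using \<U>(3) by auto
    ultimately show ?thesis by simp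
  qed
qed

text \<open>The complement of a rectangle is the union of two cylinders, the preimages under the
  projections of the complements of its sides.\<close>

lemma Pi_class_Times:
  assumes A: "A \<in> Pi_class \<alpha> T" and B: "B \<in> Pi_class \<alpha> T'"
  shows "A \<times> B \<in> Pi_class \<alpha> (prod_topology T T')"
proof -
  let ?P = "prod_topology T T'"
  have "{p \<in> topspace ?P. fst p \<in> topspace T - A} \<union> {p \<in> topspace ?P. snd p \<in> topspace T' - B}
      \<in> Sigma_class \<alpha> ?P"
    using A B
    by (intro Sigma_class_Un Sigma_class_continuous_preimage[OF continuous_map_fst]
        Sigma_class_continuous_preimage[OF continuous_map_snd]) (auto simp: Pi_class_iff)
  moreover have "{p \<in> topspace ?P. fst p \<in> topspace T - A}
      \<union> {p \<in> topspace ?P. snd p \<in> topspace T' - B} = topspace ?P - A \<times> B"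
    by auto
  ultimately show ?thesis
    using A B by (auto simp: Pi_class_iff)
qed

text \<open>
  Two lower classes are replaced by their maximum inside the factors, because the Borel
  hierarchy of the product topology need not be increasing.
\<close>

lemma Sigma_class_Times:
  assumes T: "\<And>C. closedin T C \<Longrightarrow> gdelta_in T C"
    and T': "\<And>C. closedin T' C \<Longrightarrow> gdelta_in T' C"
    and A: "A \<in> Sigma_class \<alpha> T" and B: "B \<in> Sigma_class \<alpha> T'"
  shows "A \<times> B \<in> Sigma_class \<alpha> (prod_topology T T')"
proof (cases "\<alpha> = 0")
  case True
  with A B show ?thesis
    by (simp add: Sigma_class_zero openin_prod_Times_iff)
next
  case False
  then have "0 < \<alpha>"
    using zero_le_omega1[of \<alpha>] by simp
  obtain \<U> where \<U>: "countable \<U>" "\<And>C. C \<in> \<U> \<Longrightarrow> \<exists>\<beta><\<alpha>. C \<in> Pi_class \<beta> T" "A = \<Union>\<U>"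
    using Sigma_classE[OF A \<open>0 < \<alpha>\<close>] by blast
  obtain \<V> where \<V>: "countable \<V>" "\<And>C. C \<in> \<V> \<Longrightarrow> \<exists>\<beta><\<alpha>. C \<in> Pi_class \<beta> T'" "B = \<Union>\<V>"
    using Sigma_classE[OF B \<open>0 < \<alpha>\<close>] by blast
  have "(\<Union>p\<in>\<U> \<times> \<V>. fst p \<times> snd p) \<in> Sigma_class \<alpha> (prod_topology T T')"
  proof (rule Sigma_class_UN)
    show "countable (\<U> \<times> \<V>)"
      using \<U>(1) \<V>(1) by simp
    fix p assume p: "p \<in> \<U> \<times> \<V>"
    obtain \<beta> \<gamma> where \<beta>: "\<beta> < \<alpha>" "fst p \<in> Pi_class \<beta> T" and \<gamma>: "\<gamma> < \<alpha>" "snd p \<in> Pi_class \<gamma> T'"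
      using p \<U>(2) \<V>(2) by (metis mem_Times_iff)
    have "fst p \<in> Pi_class (max \<beta> \<gamma>) T" "snd p \<in> Pi_class (max \<beta> \<gamma>) T'"
      using \<beta>(2) \<gamma>(2) Pi_class_mono[OF T, of \<beta> "max \<beta> \<gamma>"] Pi_class_mono[OF T', of \<gamma> "max \<beta> \<gamma>"]
      by auto
    then show "fst p \<times> snd p \<in> Sigma_class \<alpha> (prod_topology T T')"
      using \<beta>(1) \<gamma>(1) by (intro Pi_class_imp_Sigma_class[OF Pi_class_Times, where \<beta> = "max \<beta> \<gamma>"]) auto
  qed
  moreover have "(\<Union>p\<in>\<U> \<times> \<V>. fst p \<times> snd p) = A \<times> B"
    unfolding \<U>(3) \<V>(3) by auto
  ultimately show ?thesis by simp
qed

text \<open>The intersection is the preimage of \<open>A \<times> B\<close> under the diagonal map,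
  so the result on rectangles applies.\<close>

lemma Sigma_class_Int:
  assumes T: "\<And>C. closedin T C \<Longrightarrow> gdelta_in T C"
    and "A \<in> Sigma_class \<alpha> T" and "B \<in> Sigma_class \<alpha> T"
  shows "A \<inter> B \<in> Sigma_class \<alpha> T"
proof -
  have "{x \<in> topspace T. (x, x) \<in> A \<times> B} \<in> Sigma_class \<alpha> T"
    using assms
    by (intro Sigma_class_continuous_preimage[where T' = "prod_topology T T"] Sigma_class_Times)
      (auto simp: continuous_map_pairwise o_def)
  moreover have "{x \<in> topspace T. (x, x) \<in> A \<times> B} = A \<inter> B"
    using Sigma_class_subset_topspace[OF assms(2)] by auto
  ultimately show ?thesis by simp
qed

section \<open>Open exhaustions, compactness and semicontinuity\<close>

text \<open>\<open>G\<close> is a countable union of closed sets, and normality enlarges each of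
  them to an open set whose closure stays in \<open>G\<close>. Partial unions make the sequence
  increasing.\<close>

lemma perfectly_normal_space_open_exhaustion:
  assumes "perfectly_normal_space T" and "openin T G"
  obtains V :: "nat \<Rightarrow> 'a set"
  where "\<And>n. openin T (V n)" "incseq V" "\<And>n. T closure_of V n \<subseteq> G" "(\<Union>n. V n) = G"
proof -
  have "fsigma_in T G"
    using assms
    by (simp add: perfectly_normal_space_def fsigma_in_gdelta_in openin_subset closedin_diff)
  then obtain C where C: "\<And>n::nat. closedin T (C n)" "(\<Union>n. C n) = G"
    by (auto simp: fsigma_in_ascending)
  have "\<exists>W. openin T W \<and> C n \<subseteq> W \<and> T closure_of W \<subseteq> G" for n
  proof -
    have "normal_space T"
      using assms(1) by (simp add: perfectly_normal_space_def)
    moreover have "C n \<subseteq> G"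
      using C(2) by blast
    ultimately show ?thesis
      using C(1) assms(2) unfolding normal_space_alt by blast
  qed
  then obtain W where W: "\<And>n. openin T (W n)" "\<And>n. C n \<subseteq> W n" "\<And>n. T closure_of W n \<subseteq> G"
    by metis
  show thesis
  proof (rule that[of "\<lambda>n. \<Union>i\<le>n. W i"])
    show "openin T (\<Union>i\<le>n. W i)" for n
      using W(1) by blast
    show "incseq (\<lambda>n. \<Union>i\<le>n. W i)"
      by (fastforce simp: incseq_def)
    \<comment> \<open>The union is finite, so the closure distributes over it.\<close>
    show "T closure_of (\<Union>i\<le>n. W i) \<subseteq> G" for n
      using W(3) by (auto simp: closure_of_Union)
    have "W n \<subseteq> G" for n
      using closure_of_subset[OF openin_subset[OF W(1)[of n]]] W(3)[of n] by blast
    then show "(\<Union>n. \<Union>i\<le>n. W i) = G"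
      using W(2) C(2) by blast
  qed
qed

lemma compactin_subset_incseq:
  fixes V :: "nat \<Rightarrow> 'a set"
  assumes "compactin T K" and "\<And>n. openin T (V n)" and "incseq V" and "K \<subseteq> (\<Union>n. V n)"
  obtains n where "K \<subseteq> V n"
proof -
  have "\<exists>\<F>. finite \<F> \<and> \<F> \<subseteq> range V \<and> K \<subseteq> \<Union>\<F>"
    using assms by (intro compactinD) auto
  then obtain I where I: "finite I" "K \<subseteq> (\<Union>i\<in>I. V i)"
    by (metis finite_subset_image)
  \<comment> \<open>If \<open>I\<close> is empty, \<open>Max I\<close> is an unspecified number, but
    then \<open>K\<close> is empty and any index works.\<close>
  have "V i \<subseteq> V (Max I)" if "i \<in> I" for i
    using that I(1) assms(3) by (auto simp: incseq_def)
  then show thesis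
    using I(2) by (intro that[of "Max I"]) blast
qed

lemma upper_semicontinuous_filterbase:
  assumes "upper_semicontinuous T Z \<Phi>" and "openin Z G" and "v \<in> topspace T" and "\<Phi> v \<subseteq> G"
    and "nhd_filterbase T v \<N>"
  obtains N where "N \<in> \<N>" "\<And>y. y \<in> N \<Longrightarrow> \<Phi> y \<subseteq> G"
proof -
  have "openin T (upper_inverse (topspace T) \<Phi> G)" "v \<in> upper_inverse (topspace T) \<Phi> G"
    using assms by (auto simp: upper_semicontinuous_def upper_inverse_def)
  then have "nhd_in T v (upper_inverse (topspace T) \<Phi> G)"
    by (auto simp: nhd_in_def openin_subset)
  then show thesis
    using assms(5) that by (fastforce simp: nhd_filterbase_def upper_inverse_def)
qed

text \<open>Otherwise the points whose values meet the open complement of \<open>C\<close> form an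
  open set around \<open>v\<close>. Its intersection with an open neighbourhood of \<open>v\<close>
  inside \<open>N\<close> contains a point of \<open>S\<close>, contradicting
  \<open>sub\<close>.\<close>

lemma lower_semicontinuous_dense_subset:
  assumes lsc: "lower_semicontinuous T Z \<Phi>" and C: "closedin Z C" and "\<Phi> v \<subseteq> topspace Z"
    and v: "v \<in> T closure_of S" and N: "nhd_in T v N"
    and sub: "\<And>y. y \<in> S \<inter> N \<Longrightarrow> \<Phi> y \<subseteq> C"
  shows "\<Phi> v \<subseteq> C"
proof (rule ccontr)
  let ?L = "lower_inverse (topspace T) \<Phi> (topspace Z - C)"
  assume "\<not> \<Phi> v \<subseteq> C"
  then have "v \<in> ?L"
    using assms(3) v by (auto simp: lower_inverse_def in_closure_of)
  moreover have "openin T ?L"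
    using lsc C by (auto simp: lower_semicontinuous_def)
  moreover obtain W where W: "openin T W" "v \<in> W" "W \<subseteq> N"
    using N by (auto simp: nhd_in_def)
  ultimately have "openin T (?L \<inter> W)" "v \<in> ?L \<inter> W"
    by auto
  then obtain y where "y \<in> S" "y \<in> ?L \<inter> W"
    using v by (auto simp: in_closure_of)
  then show False
    using sub[of y] W(3) by (auto simp: lower_inverse_def)
qed

theorem theorem2:
  fixes \<alpha> :: omega1
    and Y :: "'y metric"
    and X :: "'x topology"
    and Z :: "'z topology"
    and TY :: "'y topology"
    and S :: "'y set"
    and U :: "'y \<Rightarrow> 'y set"
    and F :: "'x \<times> 'y \<Rightarrow> 'z set"
  assumes "perfectly_normal_space X"
    and "perfectly_normal_space Z"
    and "topspace TY = mspace Y"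
    and finer: "\<And>G. openin (mtopology_of Y) G \<Longrightarrow> openin TY G"
    and "separable_space TY"
    and "countable S" and "S \<subseteq> mspace Y" and "TY closure_of S = mspace Y"
    and "\<And>v. v \<in> mspace Y \<Longrightarrow> openin TY (U v)"
    and "\<And>y. y \<in> S \<Longrightarrow> {v \<in> mspace Y. y \<in> U v} \<in> Sigma_class \<alpha> (mtopology_of Y)"
    and "\<And>v. v \<in> mspace Y \<Longrightarrow>
           nhd_filterbase TY v {U v \<inter> mball_of Y v (1 / 2 ^ n) | n :: nat. 1 \<le> n}"
    and "multifunction (topspace X \<times> mspace Y) (topspace Z) F"
    and "compact_valued (topspace X \<times> mspace Y) Z F"
    and "\<And>y. y \<in> mspace Y \<Longrightarrow> lower_Borel_class \<alpha> X Z (\<lambda>x. F (x, y))"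
    and "\<And>x. x \<in> topspace X \<Longrightarrow> continuous_multifunction TY Z (\<lambda>y. F (x, y))"
  shows "upper_Borel_class (ord_succ \<alpha>) (prod_topology X (mtopology_of Y)) Z F"
proof -
  let ?Y = "mtopology_of Y" and ?N = "\<lambda>v k. U v \<inter> mball_of Y v (1 / 2 ^ k)"
  let ?P = "prod_topology X ?Y"
  note perfX = assms(1) and perfZ = assms(2) and topTY = assms(3) and S = assms(6-8)
    and B = assms(10) and base = assms(11) and FZ = assms(12) and Fcomp = assms(13)
    and Fy = assms(14) and Fx = assms(15)
  have gdX: "gdelta_in X C" if "closedin X C" for C
    using perfX that by (simp add: perfectly_normal_space_def)
  \<comment> \<open>Metrizability supplies for \<open>Y\<close> what perfect normality supplies for
    \<open>X\<close>.\<close>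
  have gdY: "gdelta_in ?Y C" if "closedin ?Y C" for C
    using that Metric_space.metrizable_space_mtopology[OF Metric_space_mspace_mdist]
    by (auto simp: mtopology_of_def intro: closed_imp_gdelta_in)
  have ball: "mball_of Y y r \<in> Sigma_class \<alpha> ?Y" for y r
  proof -
    have "mball_of Y y r \<in> Sigma_class 0 ?Y"
      by (simp add: Sigma_class_zero mball_of_def mtopology_of_def Metric_space.openin_mball)
    then show ?thesis
      using Sigma_class_mono[OF gdY zero_le_omega1] by blast
  qed
  show ?thesis
    unfolding upper_Borel_class_def
  proof (intro allI impI)
    fix G assume "openin Z G"
    then obtain V where V: "\<And>n::nat. openin Z (V n)" "incseq V" "\<And>n. Z closure_of V n \<subseteq> G"
        "(\<Union>n. V n) = G"
      using perfectly_normal_space_open_exhaustion[OF perfZ] by blast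
    \<comment> \<open>Failure of inclusion in a closed set is expressed as meeting its open
      complement, the form to which the lower Borel class of \<open>y\<close>-sections
      applies.\<close>
    define M where "M n y = lower_inverse (topspace X) (\<lambda>x. F (x, y)) (topspace Z - Z closure_of V n)"
      for n y
    \<comment> \<open>\<open>R n k y\<close> collects the pairs that \<open>y\<close> excludes from
      \<open>A n k\<close>. Centring the ball at \<open>y\<close> instead of \<open>v\<close> makes
      the second side a fixed subset of \<open>Y\<close>.\<close>
    define R where "R n k y = M n y \<times> ({v \<in> mspace Y. y \<in> U v} \<inter> mball_of Y y (1 / 2 ^ k))"
      for n k :: nat and y
    define A where "A n k = topspace ?P - (\<Union>y\<in>S. R n k y)" for n k
    have R: "R n k y \<in> Sigma_class \<alpha> ?P" if "y \<in> S" for n k y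
    proof -
      have "y \<in> mspace Y"
        using that S(2) by blast
      then have "M n y \<in> Sigma_class \<alpha> X"
        unfolding M_def using Fy[of y]
        by (simp add: lower_Borel_class_def openin_diff)
      then show ?thesis
        unfolding R_def using that
        by (intro Sigma_class_Times[OF gdX gdY] Sigma_class_Int[OF gdY] B ball)
    qed
    have A_class: "A n k \<in> Pi_class \<alpha> ?P" for n k
      unfolding Pi_class_def A_def using S(1) R by (intro imageI Sigma_class_UN)
    \<comment> \<open>Symmetry of the distance moves the centre of the ball back from
      \<open>y\<close> to \<open>v\<close>.\<close>
    have A_iff: "(x, v) \<in> A n k \<longleftrightarrow>
        x \<in> topspace X \<and> v \<in> mspace Y \<and> (\<forall>y \<in> S \<inter> ?N v k. F (x, y) \<subseteq> Z closure_of V n)" for x v n k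
    proof -
      have "F (x, y) \<subseteq> topspace Z" if "x \<in> topspace X" "y \<in> S" for y
        using FZ that S(2) by (auto simp: multifunction_def)
      then show ?thesis
        using S(2)
        by (fastforce simp: A_def R_def M_def lower_inverse_def mdist_commute)
    qed
    \<comment> \<open>\<open>k\<close> starts at 1 to match the indexing of the filterbases.\<close>
    have "upper_inverse (topspace ?P) F G = (\<Union>(n, k)\<in>UNIV \<times> {1..}. A n k)"
    proof (intro equalityI subrelI)
      fix x v assume "(x, v) \<in> upper_inverse (topspace ?P) F G"
      then have xv: "x \<in> topspace X" "v \<in> mspace Y" "F (x, v) \<subseteq> G"
        by (auto simp: upper_inverse_def)
      have "compactin Z (F (x, v))"
        using Fcomp xv by (auto simp: compact_valued_def)
      moreover have "F (x, v) \<subseteq> (\<Union>n. V n)"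
        using xv(3) V(4) by simp
      ultimately obtain n where n: "F (x, v) \<subseteq> V n"
        using compactin_subset_incseq[OF _ V(1,2)] by blast
      have "upper_semicontinuous TY Z (\<lambda>y. F (x, y))"
        using Fx[OF xv(1)] by (simp add: continuous_multifunction_def)
      then obtain N where N: "N \<in> {?N v k | k. 1 \<le> k}" "\<And>y. y \<in> N \<Longrightarrow> F (x, y) \<subseteq> V n"
        using xv(2) topTY n
        by (elim upper_semicontinuous_filterbase[OF _ V(1)[of n] _ _ base[OF xv(2)]]) auto
      then obtain k where k: "1 \<le> k" "\<And>y. y \<in> ?N v k \<Longrightarrow> F (x, y) \<subseteq> V n"
        by blast
      have "V n \<subseteq> Z closure_of V n"
        by (intro closure_of_subset openin_subset V(1))
      then have "(x, v) \<in> A n k"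
        unfolding A_iff using xv k(2) by blast
      then show "(x, v) \<in> (\<Union>(n, k)\<in>UNIV \<times> {1..}. A n k)"
        using k(1) by auto
    next
      fix x v assume "(x, v) \<in> (\<Union>(n, k)\<in>UNIV \<times> {1..}. A n k)"
      then obtain n k where k: "1 \<le> k" and "(x, v) \<in> A n k"
        by auto
      then have xv: "x \<in> topspace X" "v \<in> mspace Y"
          "\<And>y. y \<in> S \<inter> ?N v k \<Longrightarrow> F (x, y) \<subseteq> Z closure_of V n"
        unfolding A_iff by auto
      have lsc: "lower_semicontinuous TY Z (\<lambda>y. F (x, y))"
        using Fx[OF xv(1)] by (simp add: continuous_multifunction_def)
      have Fxv: "F (x, v) \<subseteq> topspace Z"
        using FZ xv by (auto simp: multifunction_def)
      have v: "v \<in> TY closure_of S"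
        using xv(2) S(3) by simp
      have N: "nhd_in TY v (?N v k)"
        using base[OF xv(2)] k unfolding nhd_filterbase_def by blast
      \<comment> \<open>Testing points of \<open>S\<close> suffices because inclusion in a closed
        set passes to \<open>v\<close>; hence the closure in \<open>A n k\<close>.\<close>
      have "F (x, v) \<subseteq> Z closure_of V n"
        by (rule lower_semicontinuous_dense_subset[OF lsc closedin_closure_of Fxv v N xv(3)])
      then show "(x, v) \<in> upper_inverse (topspace ?P) F G"
        using xv(1,2) V(3)[of n] by (auto simp: upper_inverse_def)
    qed
    \<comment> \<open>The rise from \<open>\<alpha>\<close> to \<open>ord_succ \<alpha>\<close>
      happens here: each \<open>A n k\<close> has multiplicative class
      \<open>\<alpha>\<close>.\<close>
    moreover have "(\<Union>(n, k)\<in>UNIV \<times> {1..}. A n k) \<in> Sigma_class (ord_succ \<alpha>) ?P"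
      by (intro Sigma_class_UN) (auto intro: Pi_class_imp_Sigma_class[OF A_class less_ord_succ])
    ultimately show "upper_inverse (topspace ?P) F G \<in> Sigma_class (ord_succ \<alpha>) ?P"
      by simp
  qed
qed

end
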